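(* Let $\mathbb{K}$ be $\mathbb{R}$ or $\mathbb{C}$, and let $u=(u_1,u_2,u_3):(\mathbb{K}^2,\mathbf{0})\to(\mathbb{K}^3,\mathbf{0})$ be an analytic germ having an isolated critical point at $\mathbf{0}$. Then $u$ has only transverse self-intersections if and only if $\operatorname{rank}Dw(p,q)=3$ for each $(p,q)\in V\setminus\{\mathbf{0}\}$ (near the origin). In particular, if the ideal in the ring $\mathcal{O}_{\mathbb{K},0}$ of germs of analytic functions at $\mathbf{0}\in\mathbb{K}^4$ generated by $w_1,w_2,w_3,W_{12},W_{13},W_{23}$ and all $3\times3$ minors of $Dw$ has an isolated zero at the origin, then $u$ has only transverse self-intersections near the origin.
   Context: All sets are considered as germs at the origin. For $x=(x_1,x_2)$, $y=(y_1,y_2)$ put $w_i(x,y)=u_i(x)-u_i(y)$, $1\le i\le3$, and $w=(w_1,w_2,w_3):\mathbb{K}^2\times\mathbb{K}^2=\mathbb{K}^4\to\mathbb{K}^3$. Fix (non-unique) analytic germs $c_{ik}$ at $\mathbf{0}\in\mathbb{K}^4$ with $w_i(x,y)=c_{i1}(x,y)(x_1-y_1)+c_{i2}(x,y)(x_2-y_2)$, and for $1\le i<j\le3$ put $W_{ij}=c_{i1}c_{j2}-c_{i2}c_{j1}$. Let $V\subset\mathbb{K}^4$ be the germ at $\mathbf{0}$ of the common zero set of $w_1,w_2,w_3,W_{12},W_{13},W_{23}$. "$u$ has an isolated critical point at $\mathbf{0}$" means that $\operatorname{rank}Du(\mathbf{0})<2$ and $\operatorname{rank}Du(x)=2$ for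 all $x\ne\mathbf{0}$ in some neighbourhood of $\mathbf{0}$. A self-intersection is a pair $(p,q)$ with $p\ne q$ and $u(p)=u(q)$; it is transverse if $Du(p)\mathbb{K}^2+Du(q)\mathbb{K}^2=\mathbb{K}^3$. "Only transverse self-intersections" means that, in a sufficiently small neighbourhood of the origin, all self-intersections are transverse. *)

theory Defs
  imports "HOL-Analysis.Analysis" "HOL-Algebra.Ideal"
begin

text \<open>
  The definitions are polymorphic in a real normed field \<open>'k\<close>; they are meant for
  \<open>'k = real\<close> and \<open>'k = complex\<close>. A map germ at the origin is represented by a total
  function, of which only the values near the origin matter. The space \<open>'k\<^sup>2 \<times> 'k\<^sup>2\<close> is
  identified with \<open>'k^4\<close> through \<^term>\<open>fst_pt\<close> and \<^term>\<open>snd_pt\<close> below.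
\<close>

subsection \<open>The ring of germs of analytic functions at the origin\<close>

definition monomial_at :: "('n::finite \<Rightarrow> nat) \<Rightarrow> 'k::real_normed_field^'n \<Rightarrow> 'k"
  where "monomial_at \<alpha> z = (\<Prod>i\<in>UNIV. (z $ i) ^ \<alpha> i)"

definition analytic_germ :: "('k::real_normed_field^'n \<Rightarrow> 'k) \<Rightarrow> bool"
  where "analytic_germ f \<longleftrightarrow>
    (\<exists>r>0. \<exists>a :: ('n \<Rightarrow> nat) \<Rightarrow> 'k. \<forall>z. (\<forall>i. norm (z $ i) < r) \<longrightarrow>
       (\<lambda>\<alpha>. norm (a \<alpha> * monomial_at \<alpha> z)) summable_on UNIV \<and>
       ((\<lambda>\<alpha>. a \<alpha> * monomial_at \<alpha> z) has_sum f z) UNIV)"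

text \<open>The germ of a function is its class modulo equality near the origin.\<close>

definition germ :: "('k::real_normed_field^'n \<Rightarrow> 'k) \<Rightarrow> ('k^'n \<Rightarrow> 'k) set"
  where "germ f = {g. \<forall>\<^sub>F z in nhds 0. g z = f z}"

definition germ_lift2 :: "('k \<Rightarrow> 'k \<Rightarrow> 'k) \<Rightarrow> ('k::real_normed_field^'n \<Rightarrow> 'k) set \<Rightarrow>
    ('k^'n \<Rightarrow> 'k) set \<Rightarrow> ('k^'n \<Rightarrow> 'k) set"
  where "germ_lift2 op A B = {h. \<exists>f\<in>A. \<exists>g\<in>B. \<forall>\<^sub>F z in nhds 0. h z = op (f z) (g z)}"

definition germ_ring :: "('k::real_normed_field^'n \<Rightarrow> 'k) set ring"
  where "germ_ring =
    \<lparr>carrier = germ ` {f. analytic_germ f},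
     mult = germ_lift2 (*),
     one = germ (\<lambda>_. 1),
     zero = germ (\<lambda>_. 0),
     add = germ_lift2 (+)\<rparr>"

lemma germ_eq_iff: "germ f = germ g \<longleftrightarrow> (\<forall>\<^sub>F z in nhds 0. f z = g z)"
proof
  assume "germ f = germ g"
  moreover have "f \<in> germ f" by (simp add: germ_def)
  ultimately have "f \<in> germ g" by simp
  then show "\<forall>\<^sub>F z in nhds 0. f z = g z" by (simp add: germ_def)
next
  assume e: "\<forall>\<^sub>F z in nhds 0. f z = g z"
  have "(\<forall>\<^sub>F z in nhds 0. h z = f z) \<longleftrightarrow> (\<forall>\<^sub>F z in nhds 0. h z = g z)" for h
    by (rule eventually_cong[OF e]) simp
  then show "germ f = germ g" by (simp add: germ_def)
qed

lemma germ_lift2_germ [simp]: "germ_lift2 op (germ f) (germ g) = germ (\<lambda>z. op (f z) (g z))"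
proof (intro Set.set_eqI iffI)
  fix h assume "h \<in> germ_lift2 op (germ f) (germ g)"
  then obtain f' g' where "\<forall>\<^sub>F z in nhds 0. f' z = f z" "\<forall>\<^sub>F z in nhds 0. g' z = g z"
    "\<forall>\<^sub>F z in nhds 0. h z = op (f' z) (g' z)"
    by (auto simp: germ_lift2_def germ_def)
  then have "\<forall>\<^sub>F z in nhds 0. h z = op (f z) (g z)"
    by eventually_elim simp
  then show "h \<in> germ (\<lambda>z. op (f z) (g z))" by (simp add: germ_def)
next
  fix h assume "h \<in> germ (\<lambda>z. op (f z) (g z))"
  then have "\<forall>\<^sub>F z in nhds 0. h z = op (f z) (g z)" by (simp add: germ_def)
  moreover have "f \<in> germ f" "g \<in> germ g" by (simp_all add: germ_def)
  ultimately show "h \<in> germ_lift2 op (germ f) (germ g)"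
    unfolding germ_lift2_def by (intro CollectI bexI)
qed

lemma analytic_germ_const:
  fixes c :: "'k::real_normed_field"
  shows "analytic_germ (\<lambda>_ :: 'k^'n. c)"
proof -
  have m: "monomial_at (\<lambda>_. 0) z = 1" for z :: "'k^'n"
    by (simp add: monomial_at_def)
  have "(\<lambda>\<alpha>. norm ((if \<alpha> = (\<lambda>_. 0) then c else 0) * monomial_at \<alpha> z)) summable_on UNIV \<and>
       ((\<lambda>\<alpha>. (if \<alpha> = (\<lambda>_. 0) then c else 0) * monomial_at \<alpha> z) has_sum c) UNIV"
    for z :: "'k^'n"
  proof
    have fin: "finite {\<lambda>_::'n. 0::nat}" by simp
    show "((\<lambda>\<alpha>. (if \<alpha> = (\<lambda>_. 0) then c else 0) * monomial_at \<alpha> z) has_sum c) UNIV"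
      by (rule has_sum_finite_neutralI[OF fin]) (auto simp: m)
    show "(\<lambda>\<alpha>. norm ((if \<alpha> = (\<lambda>_. 0) then c else 0) * monomial_at \<alpha> z)) summable_on UNIV"
      by (rule has_sum_imp_summable, rule has_sum_finite_neutralI[OF fin]) auto
  qed
  note key = this
  show ?thesis
    unfolding analytic_germ_def
    by (rule exI[of _ 1], rule conjI, rule zero_less_one,
        rule exI[of _ "\<lambda>\<alpha>. if \<alpha> = (\<lambda>_. 0) then c else 0"]) (intro allI impI key)
qed

lemma analytic_germ_add:
  fixes f g :: "'k::{real_normed_field,banach}^'n \<Rightarrow> 'k"
  assumes "analytic_germ f" "analytic_germ g"
  shows "analytic_germ (\<lambda>z. f z + g z)"
proof -
  from assms(1) obtain r a where r: "r > 0" and a: "\<And>z. (\<forall>i. norm (z $ i) < r) \<Longrightarrow>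
       (\<lambda>\<alpha>. norm (a \<alpha> * monomial_at \<alpha> z)) summable_on UNIV \<and>
       ((\<lambda>\<alpha>. a \<alpha> * monomial_at \<alpha> z) has_sum f z) UNIV"
    unfolding analytic_germ_def by blast
  from assms(2) obtain s b where s: "s > 0" and b: "\<And>z. (\<forall>i. norm (z $ i) < s) \<Longrightarrow>
       (\<lambda>\<alpha>. norm (b \<alpha> * monomial_at \<alpha> z)) summable_on UNIV \<and>
       ((\<lambda>\<alpha>. b \<alpha> * monomial_at \<alpha> z) has_sum g z) UNIV"
    unfolding analytic_germ_def by blast
  have "(\<lambda>\<alpha>. norm ((a \<alpha> + b \<alpha>) * monomial_at \<alpha> z)) summable_on UNIV \<and>
       ((\<lambda>\<alpha>. (a \<alpha> + b \<alpha>) * monomial_at \<alpha> z) has_sum f z + g z) UNIV"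
    if "\<forall>i. norm (z $ i) < min r s" for z
  proof
    have A: "(\<lambda>\<alpha>. norm (a \<alpha> * monomial_at \<alpha> z)) summable_on UNIV"
      "((\<lambda>\<alpha>. a \<alpha> * monomial_at \<alpha> z) has_sum f z) UNIV"
      and B: "(\<lambda>\<alpha>. norm (b \<alpha> * monomial_at \<alpha> z)) summable_on UNIV"
      "((\<lambda>\<alpha>. b \<alpha> * monomial_at \<alpha> z) has_sum g z) UNIV"
      using a[of z] b[of z] that by auto
    show "((\<lambda>\<alpha>. (a \<alpha> + b \<alpha>) * monomial_at \<alpha> z) has_sum f z + g z) UNIV"
      using has_sum_add[OF A(2) B(2)] by (simp add: distrib_right)
    show "(\<lambda>\<alpha>. norm ((a \<alpha> + b \<alpha>) * monomial_at \<alpha> z)) summable_on UNIV"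
      by (rule Infinite_Sum.abs_summable_on_comparison_test'[OF summable_on_add[OF A(1) B(1)]])
        (simp add: distrib_right norm_triangle_ineq)
  qed
  note key = this
  have "min r s > 0" using r s by simp
  moreover have "\<exists>d. \<forall>z. (\<forall>i. norm (z $ i) < min r s) \<longrightarrow>
       (\<lambda>\<alpha>. norm (d \<alpha> * monomial_at \<alpha> z)) summable_on UNIV \<and>
       ((\<lambda>\<alpha>. d \<alpha> * monomial_at \<alpha> z) has_sum f z + g z) UNIV"
    by (rule exI[of _ "\<lambda>\<alpha>. a \<alpha> + b \<alpha>"]) (intro allI impI, rule key)
  ultimately show ?thesis
    unfolding analytic_germ_def by (intro exI[of _ "min r s"] conjI)
qed

lemma analytic_germ_mult:
  fixes f g :: "'k::{real_normed_field,banach}^'n \<Rightarrow> 'k"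
  assumes "analytic_germ f" "analytic_germ g"
  shows "analytic_germ (\<lambda>z. f z * g z)"
proof -
  from assms(1) obtain r a where r: "r > 0" and a: "\<And>z. (\<forall>i. norm (z $ i) < r) \<Longrightarrow>
       (\<lambda>\<alpha>. norm (a \<alpha> * monomial_at \<alpha> z)) summable_on UNIV \<and>
       ((\<lambda>\<alpha>. a \<alpha> * monomial_at \<alpha> z) has_sum f z) UNIV"
    unfolding analytic_germ_def by blast
  from assms(2) obtain s b where s: "s > 0" and b: "\<And>z. (\<forall>i. norm (z $ i) < s) \<Longrightarrow>
       (\<lambda>\<alpha>. norm (b \<alpha> * monomial_at \<alpha> z)) summable_on UNIV \<and>
       ((\<lambda>\<alpha>. b \<alpha> * monomial_at \<alpha> z) has_sum g z) UNIV"
    unfolding analytic_germ_def by blast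
  define S :: "('n \<Rightarrow> nat) \<Rightarrow> ('n \<Rightarrow> nat) set" where "S = (\<lambda>\<gamma>. {\<alpha>. \<forall>i. \<alpha> i \<le> \<gamma> i})"
  have finS: "finite (S \<gamma>)" for \<gamma>
  proof -
    have "S \<gamma> = PiE UNIV (\<lambda>i. {..\<gamma> i})" by (auto simp: S_def PiE_def Pi_def)
    then show ?thesis by (simp add: finite_PiE)
  qed
  define c where "c = (\<lambda>\<gamma>. \<Sum>\<alpha>\<in>S \<gamma>. a \<alpha> * b (\<lambda>i. \<gamma> i - \<alpha> i))"
  have "(\<lambda>\<alpha>. norm (c \<alpha> * monomial_at \<alpha> z)) summable_on UNIV \<and>
       ((\<lambda>\<alpha>. c \<alpha> * monomial_at \<alpha> z) has_sum f z * g z) UNIV"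
    if "\<forall>i. norm (z $ i) < min r s" for z
  proof -
    define A where "A = (\<lambda>\<alpha>. a \<alpha> * monomial_at \<alpha> z)"
    define B where "B = (\<lambda>\<alpha>. b \<alpha> * monomial_at \<alpha> z)"
    have A: "(\<lambda>x. norm (A x)) summable_on UNIV" "(A has_sum f z) UNIV"
      and B: "(\<lambda>x. norm (B x)) summable_on UNIV" "(B has_sum g z) UNIV"
      using a[of z] b[of z] that by (auto simp: A_def B_def)
    have P: "(\<lambda>x. norm ((\<lambda>(\<alpha>,\<beta>). A \<alpha> * B \<beta>) x)) summable_on UNIV \<times> UNIV"
      unfolding Infinite_Sum.abs_summable_on_Sigma_iff
      by (simp add: norm_mult infsum_cmult_right' infsum_nonneg
          summable_on_cmult_right[OF B(1)] summable_on_cmult_left[OF A(1)])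
    then have Psum: "(\<lambda>(\<alpha>,\<beta>). A \<alpha> * B \<beta>) summable_on UNIV \<times> UNIV"
      by (rule abs_summable_summable)
    have Phs: "((\<lambda>(\<alpha>,\<beta>). A \<alpha> * B \<beta>) has_sum f z * g z) (UNIV \<times> UNIV)"
    proof (rule has_sum_SigmaI[where g = "\<lambda>\<alpha>. A \<alpha> * g z", OF _ _ Psum])
      show "((\<lambda>\<alpha>. A \<alpha> * g z) has_sum f z * g z) UNIV"
        by (rule has_sum_cmult_left[OF A(2)])
      show "((\<lambda>\<beta>. case (\<alpha>, \<beta>) of (\<alpha>, \<beta>) \<Rightarrow> A \<alpha> * B \<beta>) has_sum A \<alpha> * g z) UNIV" for \<alpha>
        using has_sum_cmult_right[OF B(2)] by simp
    qed
    define \<phi> :: "(('n \<Rightarrow> nat) \<times> ('n \<Rightarrow> nat)) \<Rightarrow> _" where "\<phi> = (\<lambda>(\<gamma>,\<alpha>). (\<alpha>, \<lambda>i. \<gamma> i - \<alpha> i))"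
    define \<psi> :: "(('n \<Rightarrow> nat) \<times> ('n \<Rightarrow> nat)) \<Rightarrow> _" where "\<psi> = (\<lambda>(\<alpha>,\<beta>). (\<lambda>i. \<alpha> i + \<beta> i, \<alpha>))"
    have bij: "bij_betw \<phi> (Sigma UNIV S) (UNIV \<times> UNIV)"
      by (rule bij_betwI[where g = \<psi>]) (auto simp: \<phi>_def \<psi>_def S_def)
    define Q where "Q = (\<lambda>(\<gamma>,\<alpha>). A \<alpha> * B (\<lambda>i. \<gamma> i - \<alpha> i))"
    have Q\<phi>: "Q = (\<lambda>x. (\<lambda>(\<alpha>,\<beta>). A \<alpha> * B \<beta>) (\<phi> x))"
      by (simp add: Q_def \<phi>_def split_beta fun_eq_iff)
    have Qabs: "(\<lambda>x. norm (Q x)) summable_on Sigma UNIV S"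
      unfolding Q\<phi>
      using summable_on_reindex_bij_betw[OF bij, of "\<lambda>p. norm ((\<lambda>(\<alpha>,\<beta>). A \<alpha> * B \<beta>) p)"] P
      by blast
    have Qhs: "(Q has_sum f z * g z) (Sigma UNIV S)"
      unfolding Q\<phi> by (rule has_sum_reindex_bij_betw[OF bij, THEN iffD2, OF Phs])
    have trm: "(\<Sum>\<alpha>\<in>S \<gamma>. Q (\<gamma>, \<alpha>)) = c \<gamma> * monomial_at \<gamma> z" for \<gamma>
    proof -
      have "monomial_at \<alpha> z * monomial_at (\<lambda>i. \<gamma> i - \<alpha> i) z = monomial_at \<gamma> z" if "\<alpha> \<in> S \<gamma>" for \<alpha>
        using that by (simp add: monomial_at_def S_def flip: prod.distrib power_add)
      note mono = this
      have "Q (\<gamma>, \<alpha>) = a \<alpha> * b (\<lambda>i. \<gamma> i - \<alpha> i) * monomial_at \<gamma> z" if "\<alpha> \<in> S \<gamma>" for \<alpha>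
        unfolding mono[OF that, symmetric] by (simp add: Q_def A_def B_def mult_ac)
      then show ?thesis by (simp add: c_def sum_distrib_right)
    qed
    have hs: "((\<lambda>\<gamma>. c \<gamma> * monomial_at \<gamma> z) has_sum f z * g z) UNIV"
    proof (rule has_sum_SigmaD[OF Qhs])
      fix \<gamma> show "((\<lambda>y. Q (\<gamma>, y)) has_sum c \<gamma> * monomial_at \<gamma> z) (S \<gamma>)"
        by (rule has_sum_finiteI[OF finS]) (simp add: trm)
    qed
    have "(\<lambda>\<gamma>. norm (\<Sum>\<^sub>\<infinity>\<alpha>\<in>S \<gamma>. norm (Q (\<gamma>, \<alpha>)))) summable_on UNIV"
      using Qabs Infinite_Sum.abs_summable_on_Sigma_iff[of Q UNIV S] by blast
    then have n: "(\<lambda>\<gamma>. \<Sum>\<alpha>\<in>S \<gamma>. norm (Q (\<gamma>, \<alpha>))) summable_on UNIV"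
      by (simp add: finS sum_nonneg)
    have "(\<lambda>\<gamma>. norm (c \<gamma> * monomial_at \<gamma> z)) summable_on UNIV"
      by (rule Infinite_Sum.abs_summable_on_comparison_test'[OF n])
         (simp add: norm_sum flip: trm)
    with hs show ?thesis by simp
  qed
  note key = this
  have "min r s > 0" using r s by simp
  moreover have "\<exists>d. \<forall>z. (\<forall>i. norm (z $ i) < min r s) \<longrightarrow>
       (\<lambda>\<alpha>. norm (d \<alpha> * monomial_at \<alpha> z)) summable_on UNIV \<and>
       ((\<lambda>\<alpha>. d \<alpha> * monomial_at \<alpha> z) has_sum f z * g z) UNIV"
    by (rule exI[of _ "c"]) (intro allI impI, rule key)
  ultimately show ?thesis
    unfolding analytic_germ_def by (intro exI[of _ "min r s"] conjI)
qed

lemma cring_germ_ring: "cring (germ_ring :: ('k::{real_normed_field,banach}^'n \<Rightarrow> 'k) set ring)"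
proof (rule cringI)
  let ?R = "germ_ring :: ('k^'n \<Rightarrow> 'k) set ring"
  show "abelian_group ?R"
  proof (rule abelian_groupI)
    fix x assume "x \<in> carrier ?R"
    then obtain f where f: "x = germ f" "analytic_germ f" by (auto simp: germ_ring_def)
    have "analytic_germ (\<lambda>z. (-1) * f z)"
      by (rule analytic_germ_mult[OF analytic_germ_const f(2)])
    then show "\<exists>y\<in>carrier ?R. y \<oplus>\<^bsub>?R\<^esub> x = \<zero>\<^bsub>?R\<^esub>"
      using f by (intro bexI[of _ "germ (\<lambda>z. (-1) * f z)"]) (auto simp: germ_ring_def)
  qed (auto simp: germ_ring_def analytic_germ_const add_ac intro!: imageI analytic_germ_add)
  show "comm_monoid ?R"
    by (rule comm_monoidI)
      (auto simp: germ_ring_def analytic_germ_const mult_ac intro!: imageI analytic_germ_mult)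
qed (auto simp: germ_ring_def distrib_right)

text \<open>
  An ideal \<open>I\<close> has an isolated zero at the origin if its zero set, which is that of any finite
  system \<open>F\<close> of (representatives of) generators of \<open>I\<close>, is \<open>{0}\<close> near the origin.
\<close>

definition isolated_zero :: "('k::real_normed_field^'n \<Rightarrow> 'k) set set \<Rightarrow> bool"
  where "isolated_zero I \<longleftrightarrow>
    (\<exists>F. finite F \<and> (\<forall>f\<in>F. analytic_germ f) \<and> I = Idl\<^bsub>germ_ring\<^esub> (germ ` F) \<and>
       (\<forall>f\<in>F. f 0 = 0) \<and> (\<forall>\<^sub>F z in at 0. \<exists>f\<in>F. f z \<noteq> 0))"


subsection \<open>Self-intersections of a map germ\<close>

text \<open>
  The \<open>'k\<close>-linear derivative of a \<open>'k\<close>-analytic map is also its real Frechet derivative, so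
  for \<open>'k = complex\<close> the matrix below is the complex Jacobian matrix.
\<close>

definition Dmat :: "('k::real_normed_field^'n \<Rightarrow> 'k^'m) \<Rightarrow> 'k^'n \<Rightarrow> 'k^'n^'m"
  where "Dmat f x = matrix (frechet_derivative f (at x))"

definition analytic_map_germ :: "('k::real_normed_field^'n \<Rightarrow> 'k^'m) \<Rightarrow> bool"
  where "analytic_map_germ f \<longleftrightarrow> (\<forall>i. analytic_germ (\<lambda>x. f x $ i))"

definition isolated_critical_point :: "('k::real_normed_field^2 \<Rightarrow> 'k^3) \<Rightarrow> bool"
  where "isolated_critical_point u \<longleftrightarrow>
    rank (Dmat u 0) < 2 \<and> (\<forall>\<^sub>F x in at 0. rank (Dmat u x) = 2)"

definition only_transverse_self_intersections :: "('k::real_normed_field^2 \<Rightarrow> 'k^3) \<Rightarrow> bool"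
  where "only_transverse_self_intersections u \<longleftrightarrow>
    (\<exists>U. open U \<and> 0 \<in> U \<and>
      (\<forall>p\<in>U. \<forall>q\<in>U. p \<noteq> q \<and> u p = u q \<longrightarrow>
         {Dmat u p *v a + Dmat u q *v b | a b. True} = UNIV))"

definition fst_pt :: "'k^4 \<Rightarrow> 'k::real_normed_field^2"
  where "fst_pt z = vector [z $ 1, z $ 2]"

definition snd_pt :: "'k^4 \<Rightarrow> 'k::real_normed_field^2"
  where "snd_pt z = vector [z $ 3, z $ 4]"

definition wmap :: "('k::real_normed_field^2 \<Rightarrow> 'k^3) \<Rightarrow> 'k^4 \<Rightarrow> 'k^3"
  where "wmap u z = u (fst_pt z) - u (snd_pt z)"

text \<open>The entries \<open>c z $ i $ k\<close> are the coefficients \<open>c\<^sub>i\<^sub>k\<close> of \<open>w\<^sub>i\<close> with respect to \<open>x\<^sub>k - y\<^sub>k\<close>.\<close>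

definition difference_coeffs :: "('k::real_normed_field^2 \<Rightarrow> 'k^3) \<Rightarrow> ('k^4 \<Rightarrow> 'k^2^3) \<Rightarrow> bool"
  where "difference_coeffs u c \<longleftrightarrow>
    (\<forall>i k. analytic_germ (\<lambda>z. c z $ i $ k)) \<and>
    (\<forall>\<^sub>F z in nhds 0. \<forall>i.
       wmap u z $ i = c z $ i $ 1 * (z $ 1 - z $ 3) + c z $ i $ 2 * (z $ 2 - z $ 4))"

definition Wminor :: "('k::real_normed_field^4 \<Rightarrow> 'k^2^3) \<Rightarrow> 3 \<Rightarrow> 3 \<Rightarrow> 'k^4 \<Rightarrow> 'k"
  where "Wminor c i j z = c z $ i $ 1 * c z $ j $ 2 - c z $ i $ 2 * c z $ j $ 1"

definition wW_functions ::
    "('k::real_normed_field^2 \<Rightarrow> 'k^3) \<Rightarrow> ('k^4 \<Rightarrow> 'k^2^3) \<Rightarrow> ('k^4 \<Rightarrow> 'k) set"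
  where "wW_functions u c =
    {\<lambda>z. wmap u z $ 1, \<lambda>z. wmap u z $ 2, \<lambda>z. wmap u z $ 3,
     Wminor c 1 2, Wminor c 1 3, Wminor c 2 3}"

definition V_locus :: "('k::real_normed_field^2 \<Rightarrow> 'k^3) \<Rightarrow> ('k^4 \<Rightarrow> 'k^2^3) \<Rightarrow> ('k^4) set"
  where "V_locus u c = {z. \<forall>f\<in>wW_functions u c. f z = 0}"

definition minor3 :: "'k::real_normed_field^4^3 \<Rightarrow> 4 \<Rightarrow> 4 \<Rightarrow> 4 \<Rightarrow> 'k"
  where "minor3 M j k l = det ((\<chi> i. vector [M $ i $ j, M $ i $ k, M $ i $ l]) :: 'k^3^3)"

definition Dw_minors :: "('k::real_normed_field^2 \<Rightarrow> 'k^3) \<Rightarrow> ('k^4 \<Rightarrow> 'k) set"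
  where "Dw_minors u =
    {\<lambda>z. minor3 (Dmat (wmap u) z) 1 2 3, \<lambda>z. minor3 (Dmat (wmap u) z) 1 2 4,
     \<lambda>z. minor3 (Dmat (wmap u) z) 1 3 4, \<lambda>z. minor3 (Dmat (wmap u) z) 2 3 4}"

end

theory Submission
  imports Defs
begin

text \<open>
  Off the diagonal, \<open>w(p,q) = 0\<close> makes \<open>p - q\<close> a nonzero vector in the kernel of the matrix
  \<open>(c\<^sub>i\<^sub>k(p,q))\<close>, so the \<open>W\<^sub>i\<^sub>j\<close> vanish automatically. On the diagonal \<open>c\<^sub>i\<^sub>k(p,p)\<close> is the Jacobian matrix
  of \<open>u\<close> at \<open>p\<close>, so the \<open>W\<^sub>i\<^sub>j\<close> have no common zero there except the origin. Hence
  \<open>V - {0}\<close> is exactly the set of pairs \<open>p \<noteq> q\<close> with \<open>u(p) = u(q)\<close>, and at such a pair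
  \<open>Dw = (Du(p), -Du(q))\<close> is surjective if and only if the self-intersection is transverse.
\<close>

subsection \<open>Differentiability of analytic germs\<close>

text \<open>A Weierstrass M-test: the common bound \<open>M n\<close> on the operator norms makes
  the partial sums of the derivatives converge uniformly on \<open>S\<close>, as
  \<open>has_derivative_series\<close> demands.\<close>

lemma has_derivative_series_dominated:
  fixes f :: "nat \<Rightarrow> 'a::real_normed_vector \<Rightarrow> 'b::banach"
  assumes "convex S"
    and deriv: "\<And>n x. x \<in> S \<Longrightarrow> (f n has_derivative f' n x) (at x within S)"
    and bound: "\<And>n x h. x \<in> S \<Longrightarrow> norm (f' n x h) \<le> M n * norm h"
    and M: "summable M"
    and sums: "\<And>x. x \<in> S \<Longrightarrow> (\<lambda>n. f n x) sums g x"
    and "x \<in> S"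
  shows "(g has_derivative (\<lambda>h. \<Sum>n. f' n x h)) (at x within S)"
proof -
  have dom: "summable (\<lambda>n. norm (f' n x h))" if "x \<in> S" for x h
    by (rule summable_comparison_test'[OF summable_mult2[OF M, of "norm h"], of 0])
      (use bound[OF that] in auto)
  have "\<forall>\<^sub>F n in sequentially. \<forall>x\<in>S. \<forall>h.
      norm ((\<Sum>i<n. f' i x h) - (\<Sum>i. f' i x h)) \<le> e * norm h" if e: "e > 0" for e
  proof -
    obtain N where N: "\<And>n. n \<ge> N \<Longrightarrow> norm (\<Sum>i. M (i + n)) < e"
      using suminf_exist_split[OF e M] by blast
    have "norm ((\<Sum>i<n. f' i x h) - (\<Sum>i. f' i x h)) \<le> e * norm h"
      if "n \<ge> N" "x \<in> S" for n x h
    proof -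
      have Mn: "summable (\<lambda>i. M (i + n))"
        using M by (simp add: summable_iff_shift)
      have tail: "summable (\<lambda>i. norm (f' (i + n) x h))"
        using summable_ignore_initial_segment[OF dom[OF that(2)]] .
      have "norm ((\<Sum>i<n. f' i x h) - (\<Sum>i. f' i x h)) = norm (\<Sum>i. f' (i + n) x h)"
        using suminf_minus_initial_segment[OF summable_norm_cancel[OF dom[OF that(2)]]]
        by (simp add: norm_minus_commute)
      also have "\<dots> \<le> (\<Sum>i. norm (f' (i + n) x h))"
        by (rule summable_norm[OF tail])
      also have "\<dots> \<le> (\<Sum>i. M (i + n) * norm h)"
        by (rule suminf_le[OF bound[OF that(2)] tail summable_mult2[OF Mn]])
      also have "\<dots> = (\<Sum>i. M (i + n)) * norm h"
        by (rule suminf_mult2[OF Mn, symmetric])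
      also have "\<dots> \<le> e * norm h"
        using N[OF that(1)] by (intro mult_right_mono) auto
      finally show ?thesis .
    qed
    then show ?thesis
      unfolding eventually_sequentially by blast
  qed
  \<comment> \<open>This yields some limit function \<open>g'\<close>; uniqueness of sums identifies
    it with \<open>g\<close> on \<open>S\<close>.\<close>
  from has_derivative_series[OF \<open>convex S\<close> deriv this \<open>x \<in> S\<close> sums[OF \<open>x \<in> S\<close>]]
  obtain g' where g': "\<forall>x\<in>S. (\<lambda>n. f n x) sums g' x \<and>
      (g' has_derivative (\<lambda>h. \<Sum>n. f' n x h)) (at x within S)"
    by blast
  then have "g x = g' x" if "x \<in> S" for x
    using sums[OF that] that sums_unique2 by blast
  then show ?thesis
    using g' \<open>x \<in> S\<close> has_derivative_transform by blast
qed

text \<open>This is the form that the product and power rules produce. If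
  \<open>\<alpha> i = 0\<close>, the truncated exponent \<open>\<alpha> i - 1\<close> is harmless
  because the factor \<open>of_nat (\<alpha> i)\<close> vanishes.\<close>

definition monomial_deriv ::
    "('n::finite \<Rightarrow> nat) \<Rightarrow> 'k::real_normed_field^'n \<Rightarrow> 'k^'n \<Rightarrow> 'k"
  where "monomial_deriv \<alpha> z h =
    (\<Sum>i\<in>UNIV. of_nat (\<alpha> i) * h $ i * z $ i ^ (\<alpha> i - 1) * (\<Prod>j\<in>UNIV - {i}. z $ j ^ \<alpha> j))"

lemma has_derivative_monomial_at:
  "(monomial_at \<alpha> has_derivative monomial_deriv \<alpha> z) (at z within S)"
  unfolding monomial_at_def[abs_def] monomial_deriv_def[abs_def]
  by (intro has_derivative_prod has_derivative_power
      bounded_linear.has_derivative[OF bounded_linear_vec_nth] has_derivative_ident)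

text \<open>Halving the radius absorbs the factor \<open>m\<close> created by differentiation, since
  \<open>m \<le> 2 ^ m\<close>.\<close>

lemma of_nat_mult_power_le:
  fixes s t :: real
  assumes "s > 0" "0 \<le> t" "t \<le> s / 2"
  shows "real m * t ^ (m - 1) \<le> 2 / s * s ^ m"
proof (cases m)
  case (Suc k)
  have "real m \<le> 2 ^ m"
    using of_nat_less_two_power[of m, where 'a = real] by simp
  moreover have "t ^ k \<le> (s / 2) ^ k"
    using assms by (intro power_mono) auto
  ultimately have "real m * t ^ k \<le> 2 ^ m * (s / 2) ^ k"
    using assms by (intro mult_mono) auto
  then show ?thesis
    using assms Suc by (simp add: power_divide)
qed (use assms in simp)

text \<open>The comparison is with the single point whose coordinates all equal \<open>s\<close>, so
  the bound is uniform in \<open>z\<close>. In each of the \<open>CARD('n)\<close> summands the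
  differentiated factor costs \<open>2 / s\<close>, and the other factors are at most powers of
  \<open>s\<close>.\<close>

lemma norm_monomial_deriv_le:
  fixes z :: "'k::real_normed_field^'n"
  assumes "s > 0" "norm z \<le> s / 2"
  shows "norm (monomial_deriv \<alpha> z h) \<le>
    real CARD('n) * (2 / s) * norm (monomial_at \<alpha> (vec (of_real s) :: 'k^'n)) * norm h"
proof -
  have z: "norm (z $ i) \<le> s / 2" for i
    using Finite_Cartesian_Product.norm_nth_le[of z i] assms(2) by linarith
  have "norm (of_nat (\<alpha> i) * h $ i * z $ i ^ (\<alpha> i - 1) * (\<Prod>j\<in>UNIV - {i}. z $ j ^ \<alpha> j))
      \<le> 2 / s * (\<Prod>j\<in>UNIV. s ^ \<alpha> j) * norm h" for i
  proof -
    have 1: "(\<Prod>j\<in>UNIV - {i}. norm (z $ j) ^ \<alpha> j) \<le> (\<Prod>j\<in>UNIV - {i}. s ^ \<alpha> j)"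
    proof (intro prod_mono conjI power_mono)
      show "norm (z $ j) \<le> s" for j
        using z[of j] assms(1) by linarith
    qed auto
    have 2: "real (\<alpha> i) * norm (z $ i) ^ (\<alpha> i - 1) \<le> 2 / s * s ^ \<alpha> i"
      by (rule of_nat_mult_power_le) (use assms z in auto)
    have "(real (\<alpha> i) * norm (z $ i) ^ (\<alpha> i - 1)) *
        (\<Prod>j\<in>UNIV - {i}. norm (z $ j) ^ \<alpha> j) * norm (h $ i)
      \<le> (2 / s * s ^ \<alpha> i) * (\<Prod>j\<in>UNIV - {i}. s ^ \<alpha> j) * norm h"
      using assms(1)
      by (intro mult_mono[OF mult_mono[OF 2 1]] Finite_Cartesian_Product.norm_nth_le)
        (auto intro!: mult_nonneg_nonneg divide_nonneg_nonneg prod_nonneg)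
    also have "\<dots> = 2 / s * (\<Prod>j\<in>UNIV. s ^ \<alpha> j) * norm h"
      using prod.remove[of UNIV i "\<lambda>j. s ^ \<alpha> j"] by (simp add: mult_ac)
    finally show ?thesis
      by (simp add: norm_mult norm_power mult_ac flip: prod_norm)
  qed
  then have "norm (monomial_deriv \<alpha> z h) \<le> (\<Sum>i\<in>(UNIV::'n set). 2 / s * (\<Prod>j\<in>UNIV. s ^ \<alpha> j) * norm h)"
    unfolding monomial_deriv_def by (intro sum_norm_le) auto
  then show ?thesis
    using assms(1) by (simp add: monomial_at_def norm_power mult_ac flip: prod_norm)
qed

text \<open>Enumerating the multi-indices turns the power series into a series over
  \<open>nat\<close>. Its absolute convergence at the one point \<open>p\<close> dominates the
  termwise derivatives on a smaller ball.\<close>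

lemma analytic_germ_differentiable:
  fixes f :: "'k::{real_normed_field,banach}^'n \<Rightarrow> 'k"
  assumes "analytic_germ f"
  shows "\<forall>\<^sub>F z in nhds 0. f differentiable (at z)"
proof -
  from assms obtain r a where r: "r > 0" and a: "\<And>z. (\<forall>i. norm (z $ i) < r) \<Longrightarrow>
       (\<lambda>\<alpha>. norm (a \<alpha> * monomial_at \<alpha> z)) summable_on UNIV \<and>
       ((\<lambda>\<alpha>. a \<alpha> * monomial_at \<alpha> z) has_sum f z) UNIV"
    unfolding analytic_germ_def by blast
  \<comment> \<open>\<open>s < r\<close> puts the point with all coordinates \<open>s\<close> inside
    the domain of convergence; \<open>norm_monomial_deriv_le\<close> then applies on the ball of
    radius \<open>s / 2\<close>.\<close>
  define s where "s = r / 2"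
  have s: "s > 0" "s < r"
    using r by (auto simp: s_def)
  define S :: "('k^'n) set" where "S = ball 0 (s / 2)"
  define \<phi> :: "nat \<Rightarrow> 'n \<Rightarrow> nat" where "\<phi> = from_nat_into UNIV"
  \<comment> \<open>\<open>from_nat_into\<close> is a bijection from all of \<open>nat\<close> only
    for an infinite countable set.\<close>
  have "infinite (UNIV :: ('n \<Rightarrow> nat) set)"
    by (simp add: finite_UNIV_fun)
  then have \<phi>: "bij_betw \<phi> UNIV UNIV"
    unfolding \<phi>_def by (intro bij_betw_from_nat_into) auto
  have S: "norm (z $ i) < r" if "z \<in> S" for z i
    using Finite_Cartesian_Product.norm_nth_le[of z i] that s by (auto simp: S_def)
  have sums: "(\<lambda>n. a (\<phi> n) * monomial_at (\<phi> n) z) sums f z" if "z \<in> S" for z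
    using a[of z] S[OF that] has_sum_reindex_bij_betw[OF \<phi>, of "\<lambda>\<alpha>. a \<alpha> * monomial_at \<alpha> z"]
    by (auto intro: has_sum_imp_sums)
  define p :: "'k^'n" where "p = vec (of_real s)"
  have "(\<lambda>\<alpha>. norm (a \<alpha> * monomial_at \<alpha> p)) summable_on UNIV"
    using a[of p] s by (simp add: p_def)
  then have M: "summable (\<lambda>n. norm (a (\<phi> n) * monomial_at (\<phi> n) p))"
    using summable_on_reindex_bij_betw[OF \<phi>, of "\<lambda>\<alpha>. norm (a \<alpha> * monomial_at \<alpha> p)"]
    by (auto intro: summable_on_imp_summable)
  have bound: "norm (a (\<phi> n) * monomial_deriv (\<phi> n) z h) \<le>
      real CARD('n) * (2 / s) * norm (a (\<phi> n) * monomial_at (\<phi> n) p) * norm h" if "z \<in> S" for n z h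
  proof -
    have "norm (a (\<phi> n)) * norm (monomial_deriv (\<phi> n) z h) \<le> norm (a (\<phi> n)) *
        (real CARD('n) * (2 / s) * norm (monomial_at (\<phi> n) p) * norm h)"
      unfolding p_def using that s
      by (intro mult_left_mono norm_monomial_deriv_le) (auto simp: S_def)
    then show ?thesis
      by (simp add: norm_mult mult_ac)
  qed
  have "f differentiable (at z)" if "z \<in> S" for z
  proof -
    have "(f has_derivative (\<lambda>h. \<Sum>n. a (\<phi> n) * monomial_deriv (\<phi> n) z h)) (at z within S)"
      by (rule has_derivative_series_dominated[where f = "\<lambda>n z. a (\<phi> n) * monomial_at (\<phi> n) z",
            OF _ _ bound summable_mult[OF M] sums that])
        (auto simp: S_def intro!: has_derivative_mult_right has_derivative_monomial_at)
    then show ?thesis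
      using that at_within_open[of z S] unfolding differentiable_def S_def by auto
  qed
  moreover have "open S" "0 \<in> S"
    using s by (auto simp: S_def)
  ultimately show ?thesis
    unfolding eventually_nhds by blast
qed

lemma norm_le_sum_norm_nth: "norm x \<le> (\<Sum>i\<in>UNIV. norm (x $ i))"
  unfolding norm_vec_def by (rule L2_set_le_sum) auto

text \<open>\<open>f\<close> is the sum of its components, each embedded by the bounded linear map
  \<open>axis i\<close>.\<close>

lemma differentiable_componentwise_vec:
  fixes f :: "'a::real_normed_vector \<Rightarrow> 'b::real_normed_vector^'m"
  assumes "\<And>i. (\<lambda>x. f x $ i) differentiable (at z)"
  shows "f differentiable (at z)"
proof -
  have ax: "bounded_linear (axis i :: 'b \<Rightarrow> 'b^'m)" for i
  proof (rule bounded_linear_intro[where K = 1])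
    show "norm (axis i x :: 'b^'m) \<le> norm x * 1" for x
      using norm_le_sum_norm_nth[of "axis i x"]
      by (simp add: axis_def if_distrib[of norm] cong: if_cong)
  qed (simp_all add: vec_eq_iff axis_def)
  have "(\<lambda>x. axis i (f x $ i)) differentiable (at z)" for i
    using assms[of i] bounded_linear.has_derivative[OF ax] unfolding differentiable_def by blast
  then have "(\<lambda>x. \<Sum>i\<in>UNIV. axis i (f x $ i)) differentiable (at z)"
    by (intro differentiable_sum) auto
  moreover have "f = (\<lambda>x. \<Sum>i\<in>UNIV. axis i (f x $ i))"
    by (simp add: fun_eq_iff vec_eq_iff axis_def if_distrib cong: if_cong)
  ultimately show ?thesis
    by simp
qed

lemma analytic_map_germ_differentiable:
  fixes u :: "'k::{real_normed_field,banach}^'n \<Rightarrow> 'k^'m"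
  assumes "analytic_map_germ u"
  shows "\<forall>\<^sub>F x in nhds 0. u differentiable (at x)"
proof -
  have "\<forall>\<^sub>F x in nhds 0. \<forall>i\<in>UNIV. (\<lambda>x. u x $ i) differentiable (at x)"
    using assms by (intro eventually_ball_finite ballI analytic_germ_differentiable)
      (auto simp: analytic_map_germ_def)
  then show ?thesis
    by eventually_elim (auto intro: differentiable_componentwise_vec)
qed

subsection \<open>Rank over an arbitrary field\<close>

text \<open>\<open>rows A\<close> is a set, in which equal rows collapse. Full row rank therefore
  means that the rows are distinct and form an independent set, or equivalently that the family of
  rows has only the trivial relation; this characterises right invertibility, hence
  surjectivity.\<close>

lemma rank_eq_nrows_iff_surj:
  fixes A :: "'a::field^'n^'m"
  shows "rank A = CARD('m) \<longleftrightarrow> surj ((*v) A)"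
proof -
  have rows: "rows A = range (\<lambda>i. row i A)"
    by (auto simp: rows_def)
  have "rank A = CARD('m) \<longleftrightarrow> inj (\<lambda>i. row i A) \<and> vec.independent (rows A)"
  proof
    assume r: "rank A = CARD('m)"
    have "vec.dim (rows A) \<le> card (rows A)"
      by (rule vec.dim_le_card') (simp add: rows)
    moreover have "card (rows A) \<le> CARD('m)"
      unfolding rows by (rule card_image_le) simp
    ultimately have "card (rows A) = CARD('m)"
      using r by (simp add: row_rank_def_gen)
    then show "inj (\<lambda>i. row i A) \<and> vec.independent (rows A)"
      using r rows vec.card_le_dim_spanning[of "rows A" "rows A"] vec.span_superset[of "rows A"]
      by (simp add: row_rank_def_gen eq_card_imp_inj_on)
  next
    assume "inj (\<lambda>i. row i A) \<and> vec.independent (rows A)"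
    then show "rank A = CARD('m)"
      using rows by (simp add: row_rank_def_gen vec.dim_eq_card_independent card_image)
  qed
  also have "\<dots> \<longleftrightarrow> (\<forall>c. (\<Sum>i\<in>UNIV. c i *s row i A) = 0 \<longrightarrow> (\<forall>i. c i = 0))" (is "?L \<longleftrightarrow> ?R")
  proof
    assume L: ?L
    then have inj: "inj (\<lambda>i. row i A)" ..
    show ?R
    proof (intro allI impI)
      fix c i assume c: "(\<Sum>i\<in>UNIV. c i *s row i A) = 0"
      define d where "d = (\<lambda>v. c (inv_into UNIV (\<lambda>i. row i A) v))"
      have "(\<Sum>v\<in>rows A. d v *s v) = 0"
        unfolding rows d_def using c by (simp add: sum.reindex[OF inj] inv_f_f[OF inj])
      then have "d (row i A) = 0"
        using L rows unfolding vec.independent_explicit by blast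
      then show "c i = 0"
        by (simp add: d_def inv_f_f[OF inj])
    qed
  next
    assume R: ?R
    have inj: "inj (\<lambda>i. row i A)"
    proof (rule injI, rule ccontr)
      fix i j assume ij: "row i A = row j A" "i \<noteq> j"
      \<comment> \<open>Two equal rows would satisfy the nontrivial relation with coefficients 1 and
        -1.\<close>
      define c where "c = (\<lambda>l. if l = i then 1 else if l = j then - 1 else (0::'a))"
      have "(\<Sum>l\<in>UNIV. c l *s row l A) = (\<Sum>l\<in>{i, j}. c l *s row l A)"
        by (rule sum.mono_neutral_right) (auto simp: c_def)
      also have "\<dots> = 0"
        using ij by (simp add: c_def)
      finally show False
        using R[rule_format, of c i] by (simp add: c_def)
    qed
    have "vec.independent (rows A)"
      unfolding vec.independent_explicit
    proof (intro conjI allI impI)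
      fix d assume "(\<Sum>v\<in>rows A. d v *s v) = 0"
      then have "(\<Sum>i\<in>UNIV. d (row i A) *s row i A) = 0"
        unfolding rows by (simp add: sum.reindex[OF inj])
      from R[rule_format, OF this] show "\<forall>v\<in>rows A. d v = 0"
        unfolding rows by blast
    qed (simp add: rows)
    with inj show ?L ..
  qed
  finally show ?thesis
    by (simp add: matrix_right_invertible_independent_rows[symmetric]
        matrix_right_invertible_surjective)
qed

text \<open>The rank is the dimension of the row span; it is maximal exactly when the rows span the
  whole space, which is left invertibility.\<close>

lemma rank_eq_ncols_iff_inj:
  fixes A :: "'a::field^'n^'m"
  shows "rank A = CARD('n) \<longleftrightarrow> inj ((*v) A)"
  unfolding row_rank_def_gen matrix_left_invertible_injective[symmetric]
    matrix_left_invertible_span_rows_gen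
  using vec.dim_eq_full[of "rows A"] by (simp add: card_cart_basis vec.dimension_def)

lemma rank_neq_2_if_minors_zero:
  fixes A :: "'a::field^2^3"
  assumes "\<And>i j. A $ i $ 1 * A $ j $ 2 = A $ i $ 2 * A $ j $ 1"
  shows "rank A \<noteq> 2"
proof
  assume "rank A = 2"
  then have inj: "inj ((*v) A)"
    using rank_eq_ncols_iff_inj[of A] by simp
  have ker: "v = 0" if "\<And>i. A $ i $ 1 * v $ 1 + A $ i $ 2 * v $ 2 = 0" for v :: "'a^2"
    using injD[OF inj, of v 0] that by (simp add: matrix_vector_mult_def vec_eq_iff sum_2)
  \<comment> \<open>The vanishing minors say exactly that row \<open>i\<close>, with its entries
    swapped and one sign changed, lies in the kernel. So every row is zero, and then the kernel also
    contains a coordinate vector.\<close>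
  have "A $ i $ 1 = 0 \<and> A $ i $ 2 = 0" for i
    using ker[of "vector [A $ i $ 2, - A $ i $ 1]"] assms[of _ i]
    by (simp add: vec_eq_iff forall_2 mult_ac)
  then have "axis 1 1 = (0 :: 'a^2)"
    by (intro ker) simp
  then show False
    by (simp add: axis_eq_0_iff)
qed

text \<open>The columns \<open>j\<close>, \<open>k\<close>, \<open>l\<close> of \<open>M\<close>
  form the invertible matrix \<open>N\<close>, so their combinations already fill the
  target.\<close>

lemma rank_eq_3_if_minor3_nonzero:
  fixes M :: "'k::real_normed_field^4^3"
  assumes "minor3 M j k l \<noteq> 0"
  shows "rank M = 3"
proof -
  define N :: "'k^3^3" where "N = (\<chi> i. vector [M $ i $ j, M $ i $ k, M $ i $ l])"
  have "invertible N"
    using assms by (simp add: N_def minor3_def invertible_det_nz)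
  then have "surj ((*v) N)"
    by (simp add: invertible_right_inverse flip: matrix_right_invertible_surjective)
  moreover have "N *v v = M *v (v $ 1 *s axis j 1 + v $ 2 *s axis k 1 + v $ 3 *s axis l 1)" for v
  proof -
    have "M *v axis j 1 = column j M" for j
      by (simp add: matrix_vector_mult_def column_def axis_def vec_eq_iff if_distrib cong: if_cong)
    then show ?thesis
      by (simp add: vec.add vec.scale)
        (simp add: N_def matrix_vector_mult_def vec_eq_iff sum_3 column_def mult.commute)
  qed
  ultimately have "surj ((*v) M)"
    unfolding surj_def by metis
  then show ?thesis
    using rank_eq_nrows_iff_surj[of M] by simp
qed

text \<open>Cramer's rule: the determinant times each coordinate of \<open>d\<close> is a
  combination of the two equations, and \<open>d\<close> has a nonzero coordinate.\<close>

lemma minors_zero_if_kernel: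
  fixes a b d :: "'a::field^2"
  assumes "d \<noteq> 0" "a $ 1 * d $ 1 + a $ 2 * d $ 2 = 0" "b $ 1 * d $ 1 + b $ 2 * d $ 2 = 0"
  shows "a $ 1 * b $ 2 = a $ 2 * b $ 1"
proof -
  have "(a $ 1 * b $ 2 - a $ 2 * b $ 1) * d $ 1 =
      b $ 2 * (a $ 1 * d $ 1 + a $ 2 * d $ 2) - a $ 2 * (b $ 1 * d $ 1 + b $ 2 * d $ 2)"
    "(a $ 1 * b $ 2 - a $ 2 * b $ 1) * d $ 2 =
      a $ 1 * (b $ 1 * d $ 1 + b $ 2 * d $ 2) - b $ 1 * (a $ 1 * d $ 1 + a $ 2 * d $ 2)"
    by (simp_all add: algebra_simps)
  then have "(a $ 1 * b $ 2 - a $ 2 * b $ 1) * d $ 1 = 0" "(a $ 1 * b $ 2 - a $ 2 * b $ 1) * d $ 2 = 0"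
    unfolding assms(2,3) by simp_all
  moreover have "d $ 1 \<noteq> 0 \<or> d $ 2 \<noteq> 0"
    using assms(1) by (simp add: vec_eq_iff forall_2)
  ultimately show ?thesis
    by (metis mult_eq_0_iff right_minus_eq)
qed

subsection \<open>Ideals of germs\<close>

text \<open>The analytic germs that vanish near the origin on the common zeros of \<open>G\<close>
  form an ideal. It contains the germs of \<open>G\<close>, hence the ideal they generate.\<close>

lemma Idl_germ_ring_vanish:
  fixes G :: "('k::{real_normed_field,banach}^'n \<Rightarrow> 'k) set"
  assumes "germ ` G \<subseteq> carrier germ_ring" "germ f \<in> Idl\<^bsub>germ_ring\<^esub> (germ ` G)"
  shows "\<forall>\<^sub>F z in nhds 0. (\<forall>g\<in>G. g z = 0) \<longrightarrow> f z = 0"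
proof -
  let ?R = "germ_ring :: ('k^'n \<Rightarrow> 'k) set ring"
  define P :: "('k^'n \<Rightarrow> 'k) \<Rightarrow> bool"
    where "P h \<longleftrightarrow> (\<forall>\<^sub>F z in nhds 0. (\<forall>g\<in>G. g z = 0) \<longrightarrow> h z = 0)" for h
  interpret R: cring ?R by (rule cring_germ_ring)
  \<comment> \<open>\<open>P\<close> depends on \<open>h\<close> only through its germ, so it may be
    tested on any representative.\<close>
  have P_cong: "P h'" if "germ h = germ h'" "P h" for h h'
    using that unfolding germ_eq_iff P_def by eventually_elim auto
  define J where "J = germ ` {h. analytic_germ h \<and> P h}"
  have P_iff: "germ h \<in> J \<longleftrightarrow> germ h \<in> carrier ?R \<and> P h" for h
  proof
    assume "germ h \<in> J"
    then obtain k where "germ h = germ k" "analytic_germ k" "P k"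
      unfolding J_def by blast
    then show "germ h \<in> carrier ?R \<and> P h"
      using P_cong[of k h] by (simp add: germ_ring_def)
  next
    assume "germ h \<in> carrier ?R \<and> P h"
    then obtain k where "germ h = germ k" "analytic_germ k" "P h"
      unfolding germ_ring_def by auto
    then show "germ h \<in> J"
      using P_cong[of h k] by (simp add: J_def)
  qed
  have "ideal J ?R"
  proof (rule idealI)
    show "ring ?R" by (rule R.ring_axioms)
    have add: "x \<oplus>\<^bsub>?R\<^esub> y \<in> J" if x: "x \<in> J" and y: "y \<in> J" for x y
    proof -
      obtain h where h: "x = germ h" "analytic_germ h" "P h"
        using x unfolding J_def by blast
      obtain k where k: "y = germ k" "analytic_germ k" "P k"
        using y unfolding J_def by blast
      have "P (\<lambda>z. h z + k z)"
        using h(3) k(3) unfolding P_def by eventually_elim auto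
      then show ?thesis
        using h k unfolding J_def by (auto simp: germ_ring_def analytic_germ_add)
    qed
    have mult: "x \<otimes>\<^bsub>?R\<^esub> a \<in> J" if a: "a \<in> J" and x: "x \<in> carrier ?R" for a x
    proof -
      obtain h where h: "a = germ h" "analytic_germ h" "P h"
        using a unfolding J_def by blast
      obtain k where k: "x = germ k" "analytic_germ k"
        using x by (auto simp: germ_ring_def)
      have "P (\<lambda>z. k z * h z)"
        using h(3) unfolding P_def by eventually_elim auto
      then show ?thesis
        using h k unfolding J_def by (auto simp: germ_ring_def analytic_germ_mult)
    qed
    show "x \<otimes>\<^bsub>?R\<^esub> a \<in> J" if "a \<in> J" "x \<in> carrier ?R" for a x
      by (rule mult[OF that])
    have J: "J \<subseteq> carrier ?R"
      by (auto simp: J_def germ_ring_def)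
    show "a \<otimes>\<^bsub>?R\<^esub> x \<in> J" if "a \<in> J" "x \<in> carrier ?R" for a x
      using mult[OF that] R.m_comm[OF that(2) subsetD[OF J that(1)]] by simp
    have "germ (\<lambda>_. 0 :: 'k) \<in> J"
      unfolding J_def by (intro imageI) (simp add: analytic_germ_const P_def)
    then have zero: "\<zero>\<^bsub>?R\<^esub> \<in> J"
      by (simp add: germ_ring_def)
    \<comment> \<open>Negation is multiplication by the ring element -1, so it is covered by
      \<open>mult\<close>.\<close>
    have neg: "\<ominus>\<^bsub>?R\<^esub> x \<in> J" if "x \<in> J" for x
    proof -
      have "\<ominus>\<^bsub>?R\<^esub> \<one>\<^bsub>?R\<^esub> \<otimes>\<^bsub>?R\<^esub> x = \<ominus>\<^bsub>?R\<^esub> x"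
        using subsetD[OF J that] by (simp add: R.l_minus)
      then show ?thesis
        using mult[OF that R.a_inv_closed[OF R.one_closed]] by simp
    qed
    show "subgroup J (add_monoid ?R)"
    proof (rule R.add.subgroupI)
      show "J \<noteq> {}" using zero by blast
      show "\<ominus>\<^bsub>?R\<^esub> x \<in> J" if "x \<in> J" for x
        by (rule neg[OF that])
    qed (use J add in blast)+
  qed
  moreover have "germ ` G \<subseteq> J"
    using assms(1) by (auto simp: P_iff P_def)
  ultimately have "germ f \<in> J"
    using R.genideal_minimal assms(2) by blast
  then show ?thesis
    by (simp add: P_iff P_def)
qed

text \<open>The finite system \<open>F\<close> in the definition of \<open>isolated_zero\<close> may
  differ from \<open>G\<close>. Each of its members lies in the ideal generated by the germs of
  \<open>G\<close>, so near the origin it vanishes wherever all of \<open>G\<close> does. Where some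
  member of \<open>F\<close> is nonzero, some member of \<open>G\<close> is too.\<close>

lemma isolated_zero_Idl_imp:
  fixes G :: "('k::{real_normed_field,banach}^'n \<Rightarrow> 'k) set"
  assumes "isolated_zero (Idl\<^bsub>germ_ring\<^esub> (germ ` G))"
  shows "\<forall>\<^sub>F z in at 0. \<exists>g\<in>G. g z \<noteq> 0"
proof -
  let ?R = "germ_ring :: ('k^'n \<Rightarrow> 'k) set ring"
  interpret R: cring ?R by (rule cring_germ_ring)
  from assms obtain F where F: "finite F" "\<forall>f\<in>F. analytic_germ f"
    "Idl\<^bsub>?R\<^esub> (germ ` G) = Idl\<^bsub>?R\<^esub> (germ ` F)" "\<forall>\<^sub>F z in at 0. \<exists>f\<in>F. f z \<noteq> 0"
    unfolding isolated_zero_def by blast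
  have FR: "germ ` F \<subseteq> carrier ?R"
    using F(2) by (auto simp: germ_ring_def)
  \<comment> \<open>A set that is not contained in the carrier lies in no ideal, so that the intersection defining
    \<^const>\<open>genideal\<close> would be \<^term>\<open>UNIV\<close>.\<close>
  have "Idl\<^bsub>?R\<^esub> (germ ` F) \<subseteq> carrier ?R"
    using FR R.oneideal R.genideal_minimal by blast
  \<comment> \<open>Every germ contains its representative, so the empty set is not a germ and the
    carrier is not \<open>UNIV\<close>.\<close>
  moreover have "h \<in> germ h" for h :: "'k^'n \<Rightarrow> 'k"
    by (simp add: germ_def)
  then have "{} \<notin> carrier ?R"
    by (auto simp: germ_ring_def)
  ultimately have "Idl\<^bsub>?R\<^esub> (germ ` G) \<noteq> UNIV"
    using F(3) by auto
  then obtain I where I: "ideal I ?R" "germ ` G \<subseteq> I"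
    unfolding genideal_def by blast
  have G: "germ ` G \<subseteq> carrier ?R"
    using ideal.Icarr[OF I(1)] I(2) by (intro subsetI) (drule subsetD, auto)
  have "\<forall>\<^sub>F z in nhds 0. (\<forall>g\<in>G. g z = 0) \<longrightarrow> f z = 0" if "f \<in> F" for f
    using R.genideal_self[OF FR] that F(3) by (intro Idl_germ_ring_vanish[OF G]) auto
  then have "\<forall>\<^sub>F z in nhds 0. \<forall>f\<in>F. (\<forall>g\<in>G. g z = 0) \<longrightarrow> f z = 0"
    by (intro eventually_ball_finite[OF F(1)] ballI)
  then have "\<forall>\<^sub>F z in at 0. \<forall>f\<in>F. (\<forall>g\<in>G. g z = 0) \<longrightarrow> f z = 0"
    unfolding eventually_at_filter by eventually_elim simp
  with F(4) show ?thesis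
    by eventually_elim blast
qed

subsection \<open>Double points\<close>

text \<open>Inverse to the two projections: it passes from pairs of points to points of
  \<open>'k^4\<close>.\<close>

definition pair_pt :: "'k^2 \<Rightarrow> 'k^2 \<Rightarrow> 'k::real_normed_field^4"
  where "pair_pt p q =
    (\<chi> i. if i = 1 then p $ 1 else if i = 2 then p $ 2 else if i = 3 then q $ 1 else q $ 2)"

lemma fst_pt_nth [simp]: "fst_pt z $ 1 = z $ 1" "fst_pt z $ 2 = z $ 2"
  and snd_pt_nth [simp]: "snd_pt z $ 1 = z $ 3" "snd_pt z $ 2 = z $ 4"
  by (simp_all add: fst_pt_def snd_pt_def)

lemma pair_pt_nth [simp]:
  "pair_pt p q $ 1 = p $ 1" "pair_pt p q $ 2 = p $ 2"
  "pair_pt p q $ 3 = q $ 1" "pair_pt p q $ 4 = q $ 2"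
  by (simp_all add: pair_pt_def)

lemma fst_pt_pair_pt [simp]: "fst_pt (pair_pt p q) = p"
  and snd_pt_pair_pt [simp]: "snd_pt (pair_pt p q) = q"
  by (simp_all add: vec_eq_iff forall_2)

lemma pair_pt_fst_snd [simp]: "pair_pt (fst_pt z) (snd_pt z) = z"
  by (simp add: vec_eq_iff forall_4)

lemma bounded_linear_fst_pt: "bounded_linear fst_pt"
proof (rule bounded_linear_intro[where K = 2])
  fix z :: "'k::real_normed_field^4"
  show "norm (fst_pt z) \<le> norm z * 2"
    using norm_le_sum_norm_nth[of "fst_pt z"]
      Finite_Cartesian_Product.norm_nth_le[of z 1] Finite_Cartesian_Product.norm_nth_le[of z 2]
    by (simp add: sum_2)
qed (simp_all add: vec_eq_iff forall_2)

lemma bounded_linear_snd_pt: "bounded_linear snd_pt"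
proof (rule bounded_linear_intro[where K = 2])
  fix z :: "'k::real_normed_field^4"
  show "norm (snd_pt z) \<le> norm z * 2"
    using norm_le_sum_norm_nth[of "snd_pt z"]
      Finite_Cartesian_Product.norm_nth_le[of z 3] Finite_Cartesian_Product.norm_nth_le[of z 4]
    by (simp add: sum_2)
qed (simp_all add: vec_eq_iff forall_2)

lemma fst_pt_0 [simp]: "fst_pt 0 = 0"
  and snd_pt_0 [simp]: "snd_pt 0 = 0"
  by (simp_all add: vec_eq_iff forall_2)

lemma filterlim_fst_pt: "filterlim (fst_pt :: 'k::real_normed_field^4 \<Rightarrow> 'k^2) (nhds 0) (nhds 0)"
  using linear_continuous_at[OF bounded_linear_fst_pt, of "0 :: 'k^4"]
    tendsto_at_iff_tendsto_nhds[of "fst_pt :: 'k^4 \<Rightarrow> 'k^2" 0]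
  by (simp add: continuous_at)

lemma filterlim_snd_pt: "filterlim (snd_pt :: 'k::real_normed_field^4 \<Rightarrow> 'k^2) (nhds 0) (nhds 0)"
  using linear_continuous_at[OF bounded_linear_snd_pt, of "0 :: 'k^4"]
    tendsto_at_iff_tendsto_nhds[of "snd_pt :: 'k^4 \<Rightarrow> 'k^2" 0]
  by (simp add: continuous_at)

lemma norm_pair_pt_le: "norm (pair_pt p q) \<le> 2 * norm p + 2 * norm q"
  using norm_le_sum_norm_nth[of "pair_pt p q"]
    Finite_Cartesian_Product.norm_nth_le[of p 1] Finite_Cartesian_Product.norm_nth_le[of p 2]
    Finite_Cartesian_Product.norm_nth_le[of q 1] Finite_Cartesian_Product.norm_nth_le[of q 2]
  by (simp add: sum_4)

section \<open>The Jacobian of w and the coefficients on the diagonal\<close>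

lemma Dmat_wmap_mult:
  fixes u :: "'k::real_normed_field^2 \<Rightarrow> 'k^3"
  assumes "u differentiable (at (fst_pt z))" "u differentiable (at (snd_pt z))"
  shows "Dmat (wmap u) z *v h = Dmat u (fst_pt z) *v fst_pt h - Dmat u (snd_pt z) *v snd_pt h"
proof -
  define D E where "D = frechet_derivative u (at (fst_pt z))"
    and "E = frechet_derivative u (at (snd_pt z))"
  have D: "(u has_derivative D) (at (fst_pt z))" and E: "(u has_derivative E) (at (snd_pt z))"
    using assms by (simp_all add: D_def E_def frechet_derivative_works)
  have "(wmap u has_derivative (\<lambda>h. D (fst_pt h) - E (snd_pt h))) (at z)"
    unfolding wmap_def[abs_def]
    by (intro has_derivative_diff has_derivative_compose[where f = fst_pt, OF _ D]
        has_derivative_compose[where f = snd_pt, OF _ E]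
        bounded_linear_imp_has_derivative bounded_linear_fst_pt bounded_linear_snd_pt)
  then have w: "frechet_derivative (wmap u) (at z) = (\<lambda>h. D (fst_pt h) - E (snd_pt h))"
    by (rule frechet_derivative_at[symmetric])
  \<comment> \<open>\<open>Dmat\<close> reads the derivative off at the four coordinate vectors.
    Each of them projects to a coordinate vector in one factor and to zero in the other, so
    \<open>D 0 = 0\<close> and \<open>E 0 = 0\<close> give the block form even though
    \<open>D\<close> and \<open>E\<close> are only known to be real linear.\<close>
  have axes: "fst_pt (axis 1 1 :: 'k^4) = axis 1 1" "fst_pt (axis 2 1 :: 'k^4) = axis 2 1"
    "fst_pt (axis 3 1 :: 'k^4) = 0" "fst_pt (axis 4 1 :: 'k^4) = 0"
    "snd_pt (axis 1 1 :: 'k^4) = 0" "snd_pt (axis 2 1 :: 'k^4) = 0"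
    "snd_pt (axis 3 1 :: 'k^4) = axis 1 1" "snd_pt (axis 4 1 :: 'k^4) = axis 2 1"
    by (simp_all add: vec_eq_iff forall_2 axis_def)
  have "D 0 = 0" "E 0 = 0"
    using D E by (simp_all add: has_derivative_bounded_linear linear_0 bounded_linear.linear)
  then show ?thesis
    by (simp add: Dmat_def w matrix_def matrix_vector_mult_def vec_eq_iff sum_4 sum_2 axes
        flip: D_def E_def)
qed

text \<open>The minus sign of the second block is absorbed by replacing \<open>b\<close> with
  \<open>- b\<close>, so the range of the Jacobian of \<open>wmap u\<close> is the sum of the two
  tangent images.\<close>

lemma rank_Dmat_wmap_eq_3_iff:
  fixes u :: "'k::real_normed_field^2 \<Rightarrow> 'k^3"
  assumes "u differentiable (at p)" "u differentiable (at q)"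
  shows "rank (Dmat (wmap u) (pair_pt p q)) = 3 \<longleftrightarrow>
    {Dmat u p *v a + Dmat u q *v b | a b. True} = UNIV"
proof -
  note w = Dmat_wmap_mult[of u "pair_pt p q", simplified, OF assms]
  have "range ((*v) (Dmat (wmap u) (pair_pt p q))) = {Dmat u p *v a + Dmat u q *v b | a b. True}"
  proof (intro subset_antisym subsetI)
    fix y assume "y \<in> range ((*v) (Dmat (wmap u) (pair_pt p q)))"
    then obtain h where "y = Dmat (wmap u) (pair_pt p q) *v h"
      by blast
    then have "y = Dmat u p *v fst_pt h + Dmat u q *v (- snd_pt h)"
      by (simp add: w vec.neg)
    then show "y \<in> {Dmat u p *v a + Dmat u q *v b | a b. True}"
      by blast
  next
    fix y assume "y \<in> {Dmat u p *v a + Dmat u q *v b | a b. True}"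
    then obtain a b where "y = Dmat u p *v a + Dmat u q *v b"
      by blast
    then have "y = Dmat (wmap u) (pair_pt p q) *v pair_pt a (- b)"
      by (simp add: w vec.neg)
    then show "y \<in> range ((*v) (Dmat (wmap u) (pair_pt p q)))"
      by blast
  qed
  then show ?thesis
    using rank_eq_nrows_iff_surj[of "Dmat (wmap u) (pair_pt p q)"] by simp
qed

text \<open>Only the difference quotients along the real multiples of the coordinate vectors are used, which
  suffices because the entries of \<^const>\<open>Dmat\<close> are values of the real derivative.\<close>

lemma difference_coeffs_diagonal:
  fixes u :: "'k::real_normed_field^2 \<Rightarrow> 'k^3"
  assumes u: "u differentiable (at x)"
    and c: "isCont (\<lambda>z. c z $ i $ k) (pair_pt x x)"
    and diff: "\<forall>\<^sub>F z in nhds (pair_pt x x).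
      wmap u z $ i = c z $ i $ 1 * (z $ 1 - z $ 3) + c z $ i $ 2 * (z $ 2 - z $ 4)"
  shows "Dmat u x $ i $ k = c (pair_pt x x) $ i $ k"
proof -
  define D where "D = frechet_derivative u (at x)"
  define e :: "'k^2" where "e = axis k 1"
  \<comment> \<open>Only the first point moves, along the \<open>k\<close>-th axis. The two points
    then differ by \<open>t *\<^sub>R e\<close>, so near \<open>t = 0\<close> the
    \<open>i\<close>-th component of \<open>wmap u (\<gamma> t)\<close> is \<open>t\<close> times
    the coefficient \<open>c (\<gamma> t) $ i $ k\<close>.\<close>
  define \<gamma> where "\<gamma> = (\<lambda>t. pair_pt x x + t *\<^sub>R pair_pt e 0)"
  have D: "(u has_derivative D) (at x)"
    using u by (simp add: D_def frechet_derivative_works)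
  then have D0: "(u has_derivative D) (at (x + 0 *\<^sub>R e))"
    by simp
  have lin: "D (t *\<^sub>R e) = t *\<^sub>R D e" for t
    using D by (simp add: has_derivative_bounded_linear linear_cmul bounded_linear.linear)
  have "(\<gamma> \<longlongrightarrow> pair_pt x x + 0 *\<^sub>R pair_pt e 0) (at 0)"
    unfolding \<gamma>_def by (intro tendsto_intros)
  then have \<gamma>: "(\<gamma> \<longlongrightarrow> pair_pt x x) (at 0)"
    by simp
  have fst: "fst_pt (\<gamma> t) = x + t *\<^sub>R e" and snd: "snd_pt (\<gamma> t) = x" for t
    by (simp_all add: \<gamma>_def vec_eq_iff forall_2)
  \<comment> \<open>The coefficient along \<open>\<gamma>\<close> has two limits: its value on the
    diagonal, by continuity, and a directional derivative of \<open>u\<close>. They must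
    agree.\<close>
  have "((\<lambda>t. c (\<gamma> t) $ i $ k) \<longlongrightarrow> c (pair_pt x x) $ i $ k) (at 0)"
    by (rule isCont_tendsto_compose[OF c \<gamma>])
  moreover have "((\<lambda>t. c (\<gamma> t) $ i $ k) \<longlongrightarrow> D e $ i) (at 0)"
  proof -
    have "((\<lambda>t. u (x + t *\<^sub>R e) $ i) has_derivative (\<lambda>t. D (t *\<^sub>R e) $ i)) (at (0::real))"
      by (rule bounded_linear.has_derivative[OF bounded_linear_vec_nth],
          rule has_derivative_compose[where f = "\<lambda>t. x + t *\<^sub>R e", OF _ D0])
        (auto intro!: derivative_eq_intros)
    then have "((\<lambda>t. norm (u (x + t *\<^sub>R e) $ i - u x $ i - t *\<^sub>R (D e $ i)) / norm t) \<longlongrightarrow> 0)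
        (at (0::real))"
      by (simp add: has_derivative_at lin)
    \<comment> \<open>The remainder quotient in the definition of the derivative is exactly the
      distance from the coefficient to \<open>D e $ i\<close>.\<close>
    moreover have "\<forall>\<^sub>F t in at 0. norm (u (x + t *\<^sub>R e) $ i - u x $ i - t *\<^sub>R (D e $ i)) / norm t
        = norm (c (\<gamma> t) $ i $ k - D e $ i)"
    proof -
      have "\<forall>\<^sub>F t in at 0. wmap u (\<gamma> t) $ i = c (\<gamma> t) $ i $ 1 * (\<gamma> t $ 1 - \<gamma> t $ 3) +
          c (\<gamma> t) $ i $ 2 * (\<gamma> t $ 2 - \<gamma> t $ 4)"
        by (rule eventually_compose_filterlim[OF diff \<gamma>])
      moreover have "\<forall>\<^sub>F t::real in at 0. t \<noteq> 0"
        by (simp add: eventually_at_filter)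
      ultimately show ?thesis
      proof eventually_elim
        case (elim t)
        have "c (\<gamma> t) $ i $ 1 * (\<gamma> t $ 1 - \<gamma> t $ 3) + c (\<gamma> t) $ i $ 2 * (\<gamma> t $ 2 - \<gamma> t $ 4)
            = t *\<^sub>R (c (\<gamma> t) $ i $ k)"
          using exhaust_2[of k] by (auto simp: \<gamma>_def e_def axis_def scaleR_conv_of_real[where 'a = 'k])
        then have "u (x + t *\<^sub>R e) $ i - u x $ i = t *\<^sub>R (c (\<gamma> t) $ i $ k)"
          using elim by (simp add: wmap_def fst snd)
        then have "u (x + t *\<^sub>R e) $ i - u x $ i - t *\<^sub>R (D e $ i)
            = t *\<^sub>R (c (\<gamma> t) $ i $ k - D e $ i)"
          by (simp add: scaleR_diff_right)
        then show ?case
          using elim by simp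
      qed
    qed
    ultimately have "((\<lambda>t. norm (c (\<gamma> t) $ i $ k - D e $ i)) \<longlongrightarrow> 0) (at 0)"
      by (rule Lim_transform_eventually)
    then show ?thesis
      by (simp add: tendsto_norm_zero_iff LIM_zero_iff)
  qed
  ultimately have "c (pair_pt x x) $ i $ k = D e $ i"
    by (rule tendsto_unique[OF trivial_limit_at])
  then show ?thesis
    by (simp add: Dmat_def matrix_def D_def e_def)
qed

section \<open>The locus V near the origin\<close>

lemma in_V_locus_iff:
  "z \<in> V_locus u c \<longleftrightarrow> u (fst_pt z) = u (snd_pt z) \<and>
    (\<forall>i j. c z $ i $ 1 * c z $ j $ 2 = c z $ i $ 2 * c z $ j $ 1)"
  \<comment> \<open>The minors for \<open>i < j\<close> determine all pairs: they are antisymmetric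
    in \<open>i\<close> and \<open>j\<close>, and the case \<open>i = j\<close> is
    commutativity.\<close>
  by (simp add: V_locus_def wW_functions_def wmap_def Wminor_def vec_eq_iff forall_3)
    (metis mult.commute)

lemma V_locus_eq_double_points:
  fixes u :: "'k::{real_normed_field,banach}^2 \<Rightarrow> 'k^3"
  assumes u: "analytic_map_germ u" "isolated_critical_point u" and c: "difference_coeffs u c"
  shows "\<forall>\<^sub>F z in at 0. z \<in> V_locus u c \<longleftrightarrow>
    fst_pt z \<noteq> snd_pt z \<and> u (fst_pt z) = u (snd_pt z)"
proof -
  define A where "A z \<longleftrightarrow> (\<forall>i. wmap u z $ i =
    c z $ i $ 1 * (z $ 1 - z $ 3) + c z $ i $ 2 * (z $ 2 - z $ 4))" for z
  have A: "\<forall>\<^sub>F z in nhds 0. A z"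
    using c by (simp add: difference_coeffs_def A_def)
  have C: "\<forall>\<^sub>F z in nhds 0. \<forall>i\<in>UNIV. \<forall>k\<in>UNIV. isCont (\<lambda>z. c z $ i $ k) z"
    using c by (intro eventually_ball_finite ballI eventually_mono[OF analytic_germ_differentiable])
      (auto simp: difference_coeffs_def intro: differentiable_imp_continuous_within)
  have regular: "\<forall>\<^sub>F x in nhds 0. x \<noteq> 0 \<longrightarrow> rank (Dmat u x) = 2"
    using u(2) by (simp add: isolated_critical_point_def eventually_at_filter)
  have "\<forall>\<^sub>F z in nhds 0. u differentiable (at (fst_pt z)) \<and>
      (fst_pt z \<noteq> 0 \<longrightarrow> rank (Dmat u (fst_pt z)) = 2)"
    using eventually_compose_filterlim[OF analytic_map_germ_differentiable[OF u(1)] filterlim_fst_pt]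
      eventually_compose_filterlim[OF regular filterlim_fst_pt]
    by eventually_elim blast
  \<comment> \<open>At a diagonal point the identity for \<open>wmap u\<close> must hold on a whole
    neighbourhood, because the coefficients are recovered there as limits.\<close>
  moreover have "\<forall>\<^sub>F z in nhds 0. \<forall>\<^sub>F z' in nhds z. A z'"
    using A by (simp add: eventually_eventually)
  ultimately have "\<forall>\<^sub>F z in nhds 0. z \<noteq> 0 \<longrightarrow> (z \<in> V_locus u c \<longleftrightarrow>
      fst_pt z \<noteq> snd_pt z \<and> u (fst_pt z) = u (snd_pt z))"
    using A C
  proof eventually_elim
    case (elim z)
    define p where "p = fst_pt z"
    show ?case
    proof (cases "p = snd_pt z")
      case True
      then have z: "z = pair_pt p p"
        using pair_pt_fst_snd[of z] by (simp add: p_def)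
      have "rank (Dmat u p) = 2" if "z \<noteq> 0"
      proof -
        have "p \<noteq> 0"
          using that z by (auto simp: vec_eq_iff forall_4)
        then show ?thesis
          using elim(1) by (simp add: p_def)
      qed
      moreover have "Dmat u p $ i $ k = c z $ i $ k" for i k
        unfolding z
      proof (rule difference_coeffs_diagonal)
        show "u differentiable (at p)"
          using elim(1) by (simp add: p_def)
        show "isCont (\<lambda>z. c z $ i $ k) (pair_pt p p)"
          using elim(4) z by simp
        show "\<forall>\<^sub>F z in nhds (pair_pt p p). wmap u z $ i =
            c z $ i $ 1 * (z $ 1 - z $ 3) + c z $ i $ 2 * (z $ 2 - z $ 4)"
          using elim(2) unfolding z by eventually_elim (simp add: A_def)
      qed
      ultimately have "z \<notin> V_locus u c" if "z \<noteq> 0"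
        using rank_neq_2_if_minors_zero[of "Dmat u p"] that by (auto simp: in_V_locus_iff)
      with True show ?thesis
        by (simp add: p_def)
    next
      case False
      have "c z $ i $ 1 * c z $ j $ 2 = c z $ i $ 2 * c z $ j $ 1" if "u p = u (snd_pt z)" for i j
      proof (rule minors_zero_if_kernel)
        show "p - snd_pt z \<noteq> 0"
          using False by simp
        have "c z $ i $ 1 * (z $ 1 - z $ 3) + c z $ i $ 2 * (z $ 2 - z $ 4) = 0" for i
          using elim(3) that by (simp add: A_def wmap_def p_def)
        then show "c z $ i $ 1 * (p - snd_pt z) $ 1 + c z $ i $ 2 * (p - snd_pt z) $ 2 = 0"
          "c z $ j $ 1 * (p - snd_pt z) $ 1 + c z $ j $ 2 * (p - snd_pt z) $ 2 = 0"
          by (simp_all add: p_def)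
      qed
      with False show ?thesis
        by (auto simp: in_V_locus_iff p_def)
    qed
  qed
  then show ?thesis
    by (simp add: eventually_at_filter)
qed

text \<open>Neighbourhoods of the form \<open>U \<times> U\<close> are traded for neighbourhoods in
  \<open>'k^4\<close>: one direction is continuity of the projections, the other fits a product of
  balls into a ball.\<close>

lemma only_transverse_iff_eventually:
  "only_transverse_self_intersections u \<longleftrightarrow>
    (\<forall>\<^sub>F z in nhds 0. fst_pt z \<noteq> snd_pt z \<and> u (fst_pt z) = u (snd_pt z) \<longrightarrow>
      {Dmat u (fst_pt z) *v a + Dmat u (snd_pt z) *v b | a b. True} = UNIV)"
  (is "_ \<longleftrightarrow> (\<forall>\<^sub>F z in nhds 0. ?T (fst_pt z) (snd_pt z))")
proof
  assume "only_transverse_self_intersections u"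
  then obtain U where U: "open U \<and> 0 \<in> U \<and> (\<forall>p\<in>U. \<forall>q\<in>U. ?T p q)"
    unfolding only_transverse_self_intersections_def ..
  then have nhds: "\<forall>\<^sub>F x in nhds 0. x \<in> U"
    by (simp add: eventually_nhds_in_open)
  show "\<forall>\<^sub>F z in nhds 0. ?T (fst_pt z) (snd_pt z)"
    using eventually_compose_filterlim[OF nhds filterlim_fst_pt]
      eventually_compose_filterlim[OF nhds filterlim_snd_pt]
    by eventually_elim (rule bspec[OF bspec[OF U[THEN conjunct2, THEN conjunct2]]])
next
  assume "\<forall>\<^sub>F z in nhds 0. ?T (fst_pt z) (snd_pt z)"
  then obtain d where d: "d > 0" "\<And>z. norm z < d \<Longrightarrow> ?T (fst_pt z) (snd_pt z)"
    unfolding eventually_nhds_metric by (auto simp: dist_norm)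
  \<comment> \<open>The radius \<open>d / 4\<close> comes from \<open>norm_pair_pt_le\<close>, as
    \<open>2 * (d / 4) + 2 * (d / 4) = d\<close>.\<close>
  have "?T p q" if "p \<in> ball 0 (d / 4)" "q \<in> ball 0 (d / 4)" for p q
  proof -
    have "norm (pair_pt p q) < d"
      using norm_pair_pt_le[of p q] that by simp
    from d(2)[OF this] show ?thesis by simp
  qed
  then show "only_transverse_self_intersections u"
    unfolding only_transverse_self_intersections_def
    using d(1) by (intro exI[of _ "ball 0 (d / 4)"]) auto
qed

section \<open>The rank criterion and the ideal criterion\<close>

lemma transverse_iff_rank_on_V_locus:
  fixes u :: "'k::{real_normed_field,banach}^2 \<Rightarrow> 'k^3"
  assumes "analytic_map_germ u" "isolated_critical_point u" "difference_coeffs u c"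
  shows "only_transverse_self_intersections u \<longleftrightarrow>
    (\<forall>\<^sub>F z in at 0. z \<in> V_locus u c \<longrightarrow> rank (Dmat (wmap u) z) = 3)"
proof -
  note diff = analytic_map_germ_differentiable[OF assms(1)]
  let ?T = "\<lambda>z. fst_pt z \<noteq> snd_pt z \<and> u (fst_pt z) = u (snd_pt z) \<longrightarrow>
      {Dmat u (fst_pt z) *v a + Dmat u (snd_pt z) *v b | a b. True} = UNIV"
  have "only_transverse_self_intersections u \<longleftrightarrow> (\<forall>\<^sub>F z in nhds 0. ?T z)"
    by (rule only_transverse_iff_eventually)
  \<comment> \<open>The origin may be dropped: it lies on the diagonal, where the premise of
    \<open>?T\<close> fails.\<close>
  also have "\<dots> \<longleftrightarrow> (\<forall>\<^sub>F z in at 0. ?T z)"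
    unfolding eventually_at_filter by (intro eventually_cong[OF eventually_True]) auto
  also have "\<dots> \<longleftrightarrow> (\<forall>\<^sub>F z in at 0. z \<in> V_locus u c \<longrightarrow> rank (Dmat (wmap u) z) = 3)"
  proof (rule eventually_cong)
    have "\<forall>\<^sub>F z in nhds 0. u differentiable (at (fst_pt z)) \<and> u differentiable (at (snd_pt z))"
      using eventually_compose_filterlim[OF diff filterlim_fst_pt]
        eventually_compose_filterlim[OF diff filterlim_snd_pt]
      by eventually_elim blast
    then have "\<forall>\<^sub>F z in at 0. u differentiable (at (fst_pt z)) \<and> u differentiable (at (snd_pt z))"
      unfolding eventually_at_filter by eventually_elim simp
    with V_locus_eq_double_points[OF assms]
    show "\<forall>\<^sub>F z in at 0. (z \<in> V_locus u c \<longleftrightarrow> fst_pt z \<noteq> snd_pt z \<and> u (fst_pt z) = u (snd_pt z)) \<and>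
        u differentiable (at (fst_pt z)) \<and> u differentiable (at (snd_pt z))"
      by eventually_elim blast
  next
    fix z
    assume z: "(z \<in> V_locus u c \<longleftrightarrow> fst_pt z \<noteq> snd_pt z \<and> u (fst_pt z) = u (snd_pt z)) \<and>
        u differentiable (at (fst_pt z)) \<and> u differentiable (at (snd_pt z))"
    then show "?T z \<longleftrightarrow> (z \<in> V_locus u c \<longrightarrow> rank (Dmat (wmap u) z) = 3)"
      using rank_Dmat_wmap_eq_3_iff[of u "fst_pt z" "snd_pt z"] by simp
  qed
  finally show ?thesis .
qed

text \<open>At a nonzero point of V near the origin all of \<open>wW_functions u c\<close> vanish,
  so the generator that is nonzero there must be a minor of the Jacobian of
  \<open>wmap u\<close>.\<close>

lemma transverse_if_isolated_zero:
  fixes u :: "'k::{real_normed_field,banach}^2 \<Rightarrow> 'k^3"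
  assumes "analytic_map_germ u" "isolated_critical_point u" "difference_coeffs u c"
    and "isolated_zero (Idl\<^bsub>germ_ring\<^esub> (germ ` (wW_functions u c \<union> Dw_minors u)))"
  shows "only_transverse_self_intersections u"
  unfolding transverse_iff_rank_on_V_locus[OF assms(1-3)]
  using isolated_zero_Idl_imp[OF assms(4)]
proof eventually_elim
  case (elim z)
  show ?case
  proof
    assume "z \<in> V_locus u c"
    then obtain g where "g \<in> Dw_minors u" "g z \<noteq> 0"
      using elim by (auto simp: V_locus_def)
    then show "rank (Dmat (wmap u) z) = 3"
      by (auto simp: Dw_minors_def intro: rank_eq_3_if_minor3_nonzero)
  qed
qed

theorem corollary5p4:
  shows "(\<forall>(u :: real^2 \<Rightarrow> real^3) (c :: real^4 \<Rightarrow> real^2^3).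
        analytic_map_germ u \<and> u 0 = 0 \<and> isolated_critical_point u \<and> difference_coeffs u c \<longrightarrow>
        (only_transverse_self_intersections u \<longleftrightarrow>
           (\<forall>\<^sub>F z in at 0. z \<in> V_locus u c \<longrightarrow> rank (Dmat (wmap u) z) = 3)) \<and>
        (isolated_zero (Idl\<^bsub>germ_ring\<^esub> (germ ` (wW_functions u c \<union> Dw_minors u))) \<longrightarrow>
           only_transverse_self_intersections u))
    \<and> (\<forall>(u :: complex^2 \<Rightarrow> complex^3) (c :: complex^4 \<Rightarrow> complex^2^3).
        analytic_map_germ u \<and> u 0 = 0 \<and> isolated_critical_point u \<and> difference_coeffs u c \<longrightarrow>
        (only_transverse_self_intersections u \<longleftrightarrow>
           (\<forall>\<^sub>F z in at 0. z \<in> V_locus u c \<longrightarrow> rank (Dmat (wmap u) z) = 3)) \<and>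
        (isolated_zero (Idl\<^bsub>germ_ring\<^esub> (germ ` (wW_functions u c \<union> Dw_minors u))) \<longrightarrow>
           only_transverse_self_intersections u))"
  by (intro conjI allI impI; elim conjE)
    (rule transverse_iff_rank_on_V_locus transverse_if_isolated_zero; assumption)+

end
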